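(* Let $R$ be a commutative additively idempotent semiring and let $n\ge 2$. For every $A\in M_n(R)$, $$\operatorname{per}(A\operatorname{adj}(A))=\operatorname{per}(\operatorname{adj}(A)A)=(\operatorname{per}(A))^{n}.$$
   Context: A semiring $(R,+,\cdot)$ consists of a commutative monoid $(R,+)$ with identity $0$ and a monoid $(R,\cdot)$ with identity $1\neq 0$, such that multiplication distributes over addition on both sides and $0\cdot a=a\cdot 0=0$ for all $a\in R$. It is commutative if $ab=ba$ for all $a,b\in R$, and additively idempotent if $a+a=a$ for all $a\in R$. $M_n(R)$ is the set of $n\times n$ matrices over $R$, with the usual matrix operations. For $A=(a_{ij})\in M_n(R)$, $\operatorname{per}(A)=\sum_{\sigma\in S_n}a_{1\sigma(1)}a_{2\sigma(2)}\cdots a_{n\sigma(n)}$, where $S_n$ is the symmetric group on $\{1,\dots,n\}$. The adjoint matrix $\operatorname{adj}(A)$ is the $n\times n$ matrix whose $(i,j)$ entry is $\operatorname{per}(A(j|i))$, where $A(j|i)\in M_{n-1}(R)$ is obtained from $A$ by deleting row $j$ and column $i$. *)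

theory Defs
  imports "Jordan_Normal_Form.Determinant"
begin

text \<open>Matrices are those of \<open>Jordan_Normal_Form\<close>, indexed from 0. As for the library's
  \<open>det\<close>, the non-square case is the junk value 0.\<close>

definition per :: "'a :: comm_semiring_1 mat \<Rightarrow> 'a" where
  "per A = (if dim_row A = dim_col A
     then (\<Sum> p \<in> {p. p permutes {0 ..< dim_row A}}. \<Prod> i = 0 ..< dim_row A. A $$ (i, p i))
     else 0)"

text \<open>The adjoint is formed with permanents of minors, hence without signs (unlike
  \<open>adj_mat\<close>); \<open>mat_delete A j i\<close> deletes row \<open>j\<close> and column \<open>i\<close>.\<close>

definition per_adj :: "'a :: comm_semiring_1 mat \<Rightarrow> 'a mat" where
  "per_adj A = mat (dim_row A) (dim_col A) (\<lambda>(i, j). per (mat_delete A j i))"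

end

theory Submission
  imports Defs
begin

text \<open>
  An additively idempotent semiring is partially ordered by \<open>a \<preceq> b \<longleftrightarrow> a + b = b\<close>; in this order
  a finite sum is the least upper bound of its summands, and multiplication is monotone. The
  theorem is proved as two inequalities.

  Write \<open>B = A * per_adj A\<close>. By Laplace expansion, entry \<open>(i, j)\<close> of \<open>B\<close> is the permanent of \<open>A\<close>
  with row \<open>j\<close> replaced by row \<open>i\<close>. So every diagonal entry of \<open>B\<close> is \<open>per A\<close>, and the identity
  permutation contributes the summand \<open>per A ^ n\<close> to \<open>per B\<close>. This gives \<open>per A ^ n \<preceq> per B\<close>.

  For the converse, expand \<open>per B\<close> completely into monomials in the entries of \<open>A\<close>. Such a monomial
  is given by a permutation \<open>\<sigma>\<close> and permutations \<open>\<tau> i\<close>, one for each row \<open>i\<close>: the \<open>i\<close>-th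
  factor follows \<open>\<tau> i\<close>, except that in column \<open>\<tau> i (\<sigma> i)\<close> it uses row \<open>i\<close> in place of row
  \<open>\<sigma> i\<close>. Each factor meets every column once. It omits row \<open>\<sigma> i\<close> and has row \<open>i\<close> in addition;
  since \<open>\<sigma>\<close> is a permutation, these changes cancel over all \<open>i\<close>. Hence the exponents of the
  monomial form an \<open>n \<times> n\<close> matrix of natural numbers all of whose row and column sums are \<open>n\<close>. By
  Hall's marriage theorem such a matrix is a sum of \<open>n\<close> permutation matrices (Koenig), so the
  monomial is a product of \<open>n\<close> summands of \<open>per A\<close>, and lies below \<open>per A ^ n\<close>
  (\<open>regular_monomial_below_per_power\<close>). Being the least upper bound of its monomials, \<open>per B\<close> lies
  below \<open>per A ^ n\<close> too.

  The statement about \<open>per_adj A * A\<close> follows by transposition.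
\<close>

section \<open>The natural order of an idempotent semiring\<close>

definition below :: "'a :: comm_semiring_1 \<Rightarrow> 'a \<Rightarrow> bool" (infix "\<preceq>" 50)
  where "a \<preceq> b \<longleftrightarrow> a + b = b"

lemma below_antisym: "a \<preceq> b \<Longrightarrow> b \<preceq> a \<Longrightarrow> a = b"
  by (simp add: below_def add.commute)

lemma below_trans: "a \<preceq> b \<Longrightarrow> b \<preceq> c \<Longrightarrow> a \<preceq> c"
  unfolding below_def by (metis add.assoc)

lemma below_mult_mono:
  assumes "a \<preceq> b" "c \<preceq> d"
  shows "a * c \<preceq> b * d"
proof (rule below_trans)
  show "a * c \<preceq> b * c"
    using assms(1) by (simp add: below_def flip: distrib_right)
  show "b * c \<preceq> b * d"
    using assms(2) by (simp add: below_def flip: distrib_left)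
qed

lemma sum_below:
  assumes "\<And>x. x \<in> S \<Longrightarrow> f x \<preceq> b"
  shows "sum f S \<preceq> b"
  using assms
  by (induction S rule: infinite_finite_induct) (auto simp: below_def add.assoc)

text \<open>A sum absorbs each of its summands: adding \<open>f x\<close> again only doubles it inside the sum.\<close>

lemma summand_below_sum:
  assumes idem: "\<And>a :: 'a :: comm_semiring_1. a + a = a"
    and "finite S" "x \<in> S"
  shows "f x \<preceq> (sum f S :: 'a)"
proof -
  have "sum f S = f x + sum f (S - {x})"
    using assms(2,3) by (rule sum.remove)
  then show ?thesis
    by (simp add: below_def idem flip: add.assoc)
qed

section \<open>Hall's theorem and regular nonnegative integer matrices\<close>

text \<open>
  Hall's marriage theorem, by the induction of Halmos and Vaughan. If some nonempty proper subset
  \<open>J\<close> of \<open>I\<close> is tight, it uses up all its neighbours, and Hall's condition survives for the rest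
  of \<open>I\<close> after these neighbours have been removed. If there is no such \<open>J\<close>, the slack of one
  lets an arbitrary choice be made for one index.
\<close>

lemma hall:
  fixes N :: "'i \<Rightarrow> 'b set"
  assumes "finite I" "\<And>i. i \<in> I \<Longrightarrow> finite (N i)"
    and "\<And>J. J \<subseteq> I \<Longrightarrow> card J \<le> card (\<Union>i\<in>J. N i)"
  shows "\<exists>f. inj_on f I \<and> (\<forall>i\<in>I. f i \<in> N i)"
  using assms
proof (induction I arbitrary: N rule: finite_psubset_induct)
  case (psubset I)
  note fin = psubset.prems(1) and hall = psubset.prems(2)
  have finU: "finite (\<Union>i\<in>J. N i)" if "J \<subseteq> I" for J
    using that fin psubset.hyps finite_subset by blast
  show ?case
  proof (cases "\<exists>J. J \<subset> I \<and> J \<noteq> {} \<and> card (\<Union>i\<in>J. N i) = card J")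
    case True
    then obtain J where J: "J \<subset> I" "J \<noteq> {}" "card (\<Union>i\<in>J. N i) = card J"
      by blast
    define U where "U = (\<Union>i\<in>J. N i)"
    have finJ: "finite J"
      using J(1) psubset.hyps by (meson finite_subset psubset_imp_subset)
    have "\<exists>f. inj_on f J \<and> (\<forall>i\<in>J. f i \<in> N i)"
      using J(1) fin hall by (intro psubset.IH) auto
    then obtain f where f: "inj_on f J" "\<forall>i\<in>J. f i \<in> N i"
      by blast
    have "\<exists>g. inj_on g (I - J) \<and> (\<forall>i\<in>I - J. g i \<in> N i - U)"
    proof (rule psubset.IH)
      show "I - J \<subset> I" using J(1,2) by blast
      show "finite (N i - U)" if "i \<in> I - J" for i using that fin by blast
      fix K assume K: "K \<subseteq> I - J"
      have finK: "finite K" using K psubset.hyps by (meson Diff_subset finite_subset)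
      have "card K + card J = card (K \<union> J)"
        using K finK finJ by (subst card_Un_disjoint) auto
      also have "\<dots> \<le> card (\<Union>i\<in>K \<union> J. N i)"
        using K J(1) by (intro hall) auto
      also have "(\<Union>i\<in>K \<union> J. N i) = (\<Union>i\<in>K. N i - U) \<union> U"
        by (auto simp: U_def)
      also have "card \<dots> \<le> card (\<Union>i\<in>K. N i - U) + card U"
        by (rule card_Un_le)
      finally show "card K \<le> card (\<Union>i\<in>K. N i - U)"
        using J(3) by (simp add: U_def)
    qed
    then obtain g where g: "inj_on g (I - J)" "\<forall>i\<in>I - J. g i \<in> N i - U"
      by blast
    have fU: "f i \<in> U" if "i \<in> J" for i
      using f(2) that by (auto simp: U_def)
    have "f ` J \<inter> g ` (I - J) = {}"
      using fU g(2) by force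
    then have "inj_on (\<lambda>i. if i \<in> J then f i else g i) (J \<union> (I - J))"
      by (rule inj_on_disjoint_Un[OF f(1) g(1)])
    then have "inj_on (\<lambda>i. if i \<in> J then f i else g i) I"
      using J(1) by (simp add: Un_absorb1 psubset_imp_subset)
    moreover have "\<forall>i\<in>I. (if i \<in> J then f i else g i) \<in> N i"
      using f(2) g(2) by auto
    ultimately show ?thesis
      by blast
  next
    case no_tight: False
    show ?thesis
    proof (cases "I = {}")
      case False
      then obtain x where x: "x \<in> I"
        by blast
      have "card {x} \<le> card (\<Union>i\<in>{x}. N i)"
        using x by (intro hall) auto
      then obtain y where y: "y \<in> N x"
        by fastforce
      have "\<exists>f. inj_on f (I - {x}) \<and> (\<forall>i\<in>I - {x}. f i \<in> N i - {y})"
      proof (rule psubset.IH)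
        show "I - {x} \<subset> I" using x by blast
        show "finite (N i - {y})" if "i \<in> I - {x}" for i using that fin by blast
        fix K assume K: "K \<subseteq> I - {x}"
        show "card K \<le> card (\<Union>i\<in>K. N i - {y})"
        proof (cases "K = {}")
          case False
          have "K \<subset> I" using K x by blast
          then have "card K < card (\<Union>i\<in>K. N i)"
            using no_tight hall[of K] False by (metis le_neq_implies_less psubset_imp_subset)
          then have "card K \<le> card (\<Union>i\<in>K. N i) - card {y}"
            by simp
          also have "\<dots> \<le> card ((\<Union>i\<in>K. N i) - {y})"
            by (intro diff_card_le_card_Diff) simp
          also have "(\<Union>i\<in>K. N i) - {y} = (\<Union>i\<in>K. N i - {y})"
            by blast
          finally show ?thesis .
        qed simp
      qed
      then obtain f where f: "inj_on f (I - {x})" "\<forall>i\<in>I - {x}. f i \<in> N i - {y}"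
        by blast
      have "inj_on (f(x := y)) (insert x (I - {x}))"
        using f by (subst inj_on_insert) (auto simp: inj_on_def)
      moreover have "\<forall>i\<in>I. (f(x := y)) i \<in> N i"
        using f(2) y by auto
      ultimately show ?thesis
        using x by (metis insert_Diff)
    qed simp
  qed
qed

text \<open>
  Hall's condition comes from double counting: the rows in \<open>J\<close> have total weight \<open>card J * d\<close>,
  all of it in the columns that \<open>J\<close> meets, and each of these columns holds only \<open>d\<close>.
\<close>

lemma regular_matrix_contains_permutation:
  fixes M :: "'i \<Rightarrow> 'i \<Rightarrow> nat"
  assumes fin: "finite S" and d: "d > 0"
    and row: "\<And>i. i \<in> S \<Longrightarrow> (\<Sum>j\<in>S. M i j) = d"
    and col: "\<And>j. j \<in> S \<Longrightarrow> (\<Sum>i\<in>S. M i j) = d"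
  shows "\<exists>p. p permutes S \<and> (\<forall>i\<in>S. M i (p i) > 0)"
proof -
  define N where "N i = {j \<in> S. M i j > 0}" for i
  have "\<exists>f. inj_on f S \<and> (\<forall>i\<in>S. f i \<in> N i)"
  proof (rule hall)
    fix J assume J: "J \<subseteq> S"
    define U where "U = (\<Union>i\<in>J. N i)"
    have U: "U \<subseteq> S" by (auto simp: U_def N_def)
    have "card J * d = (\<Sum>i\<in>J. \<Sum>j\<in>S. M i j)"
      using J row by (simp add: subset_iff)
    also have "\<dots> = (\<Sum>i\<in>J. \<Sum>j\<in>U. M i j)"
      using fin U by (intro sum.cong refl sum.mono_neutral_right) (auto simp: U_def N_def)
    also have "\<dots> = (\<Sum>j\<in>U. \<Sum>i\<in>J. M i j)"
      by (rule sum.swap)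
    also have "\<dots> \<le> (\<Sum>j\<in>U. \<Sum>i\<in>S. M i j)"
      using fin J by (intro sum_mono sum_mono2) auto
    also have "\<dots> = card U * d"
      using U col by (simp add: subset_iff)
    finally show "card J \<le> card (\<Union>i\<in>J. N i)"
      using d by (simp add: U_def)
  qed (use fin in \<open>auto simp: N_def\<close>)
  then obtain f where f: "inj_on f S" "\<forall>i\<in>S. f i \<in> N i"
    by blast
  define p where "p i = (if i \<in> S then f i else i)" for i
  have "f ` S = S"
    using f fin by (intro endo_inj_surj) (auto simp: N_def)
  then have "bij_betw p S S"
    using f(1) by (auto simp: bij_betw_def p_def cong: inj_on_cong)
  then have "p permutes S"
    by (rule bij_imp_permutes) (simp add: p_def)
  moreover have "\<forall>i\<in>S. M i (p i) > 0"
    using f(2) by (auto simp: p_def N_def)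
  ultimately show ?thesis
    by blast
qed

section \<open>Permanents\<close>

lemma per_carrier:
  assumes "A \<in> carrier_mat n n"
  shows "per A = (\<Sum>p | p permutes {0..<n}. \<Prod>i = 0..<n. A $$ (i, p i))"
  using assms by (auto simp: per_def)

lemma per_transpose:
  assumes A: "A \<in> carrier_mat n n"
  shows "per A\<^sup>T = per A"
proof -
  have "(\<Prod>i = 0..<n. A\<^sup>T $$ (i, Hilbert_Choice.inv p i)) = (\<Prod>i = 0..<n. A $$ (i, p i))"
    if p: "p permutes {0..<n}" for p
  proof -
    have "(\<Prod>i = 0..<n. A\<^sup>T $$ (i, Hilbert_Choice.inv p i)) = (\<Prod>i = 0..<n. A\<^sup>T $$ (p i, Hilbert_Choice.inv p (p i)))"
      using prod.permute[OF p, of "\<lambda>i. A\<^sup>T $$ (i, Hilbert_Choice.inv p i)"] by (simp add: o_def)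
    also have "\<dots> = (\<Prod>i = 0..<n. A $$ (i, p i))"
      using A permutes_in_image[OF p] by (intro prod.cong) (auto simp: permutes_inverses[OF p])
    finally show ?thesis .
  qed
  then show ?thesis
    using A by (subst (1 2) per_carrier[where n = n], simp, simp)
      (subst sum_permutations_inverse, auto intro: sum.cong)
qed

lemma permutation_insert_insert_index:
  "permutation_insert i j q (insert_index i k) = insert_index j (q k)"
  by (auto simp: permutation_insert_expand insert_index_def)

text \<open>
  Stated with the row and column numbers of \<open>A\<close> itself, the permanent of a minor needs no
  reindexing when it is multiplied by further entries of \<open>A\<close>.
\<close>

lemma per_mat_delete:
  assumes A: "A \<in> carrier_mat n n" and i: "i < n" and j: "j < n"
  shows "per (mat_delete A i j) =
    (\<Sum>p | p permutes {0..<n} \<and> p i = j. \<Prod>k\<in>{0..<n} - {i}. A $$ (k, p k))"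
proof -
  define l where "l = n - 1"
  have n: "n = Suc l" using i by (simp add: l_def)
  let ?ins = "permutation_insert i j"
  have minor: "(\<Prod>k\<in>{0..<n} - {i}. A $$ (k, ?ins q k)) =
      (\<Prod>k = 0..<l. mat_delete A i j $$ (k, q k))" if q: "q permutes {0..<l}" for q
  proof -
    have "(\<Prod>k\<in>{0..<n} - {i}. A $$ (k, ?ins q k)) =
        (\<Prod>k\<in>insert_index i ` {0..<l}. A $$ (k, ?ins q k))"
      using i by (simp add: n insert_index_image)
    also have "\<dots> = (\<Prod>k = 0..<l. A $$ (insert_index i k, insert_index j (q k)))"
      by (simp add: prod.reindex insert_index_inj_on permutation_insert_insert_index)
    also have "\<dots> = (\<Prod>k = 0..<l. mat_delete A i j $$ (k, q k))"
      using A i j permutes_in_image[OF q] by (intro prod.cong mat_delete_index) (auto simp: n)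
    finally show ?thesis .
  qed
  have "(\<Sum>p | p permutes {0..<n} \<and> p i = j. \<Prod>k\<in>{0..<n} - {i}. A $$ (k, p k)) =
      (\<Sum>p\<in>?ins ` {q. q permutes {0..<l}}. \<Prod>k\<in>{0..<n} - {i}. A $$ (k, p k))"
    using permutation_fix[of i l j] i j by (simp add: n)
  also have "\<dots> = (\<Sum>q | q permutes {0..<l}. \<Prod>k = 0..<l. mat_delete A i j $$ (k, q k))"
    using i j by (subst sum.reindex) (auto simp: n permutation_insert_inj_on minor[unfolded n] intro!: sum.cong)
  also have "\<dots> = per (mat_delete A i j)"
    using mat_delete_carrier[OF A, of i j] by (intro per_carrier[symmetric]) (simp add: l_def)
  finally show ?thesis by simp
qed

text \<open>
  The Laplace expansion along row \<open>j\<close>, with the entries of that row replaced by those of row \<open>i\<close>: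
  the permutations are grouped by the column \<open>c = p j\<close> that they assign to row \<open>j\<close>.
\<close>

lemma mult_per_adj_entry:
  assumes A: "A \<in> carrier_mat n n" and i: "i < n" and j: "j < n"
  shows "(A * per_adj A) $$ (i, j) =
    (\<Sum>p | p permutes {0..<n}. A $$ (i, p j) * (\<Prod>k\<in>{0..<n} - {j}. A $$ (k, p k)))"
proof -
  let ?P = "{p. p permutes {0..<n}}"
  let ?f = "\<lambda>p. A $$ (i, p j) * (\<Prod>k\<in>{0..<n} - {j}. A $$ (k, p k))"
  have "(A * per_adj A) $$ (i, j) = (\<Sum>c = 0..<n. A $$ (i, c) * per (mat_delete A j c))"
    using A i j by (simp add: per_adj_def scalar_prod_def)
  also have "\<dots> = (\<Sum>c = 0..<n. \<Sum>p | p \<in> ?P \<and> p j = c. ?f p)"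
    using A j by (intro sum.cong) (auto simp: per_mat_delete[where n = n] sum_distrib_left)
  also have "\<dots> = (\<Sum>p\<in>?P. ?f p)"
    using j by (intro sum.group) (auto simp: finite_permutations permutes_in_image[where S = "{0..<n}", simplified])
  finally show ?thesis .
qed

text \<open>
  The key to the upper bound. Splitting off a permutation matrix \<open>P\<close> from the exponents splits off
  a summand of \<open>per A\<close> from the monomial, and leaves exponents with row and column sums one less.
\<close>

lemma regular_monomial_below_per_power:
  fixes A :: "'a :: comm_semiring_1 mat" and M :: "nat \<Rightarrow> nat \<Rightarrow> nat"
  assumes idem: "\<And>a :: 'a. a + a = a"
    and A: "A \<in> carrier_mat n n"
    and "\<And>i. i < n \<Longrightarrow> (\<Sum>j = 0..<n. M i j) = d"
    and "\<And>j. j < n \<Longrightarrow> (\<Sum>i = 0..<n. M i j) = d"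
  shows "(\<Prod>i = 0..<n. \<Prod>j = 0..<n. A $$ (i, j) ^ M i j) \<preceq> per A ^ d"
  using assms(3,4)
proof (induction d arbitrary: M)
  case 0
  then have "(\<Prod>i = 0..<n. \<Prod>j = 0..<n. A $$ (i, j) ^ M i j) = 1"
    by (intro prod.neutral ballI) auto
  then show ?case by (simp add: below_def idem)
next
  case (Suc d)
  have "\<exists>p. p permutes {0..<n} \<and> (\<forall>i\<in>{0..<n}. M i (p i) > 0)"
    using Suc.prems by (intro regular_matrix_contains_permutation[where d = "Suc d"]) auto
  then obtain p where p: "p permutes {0..<n}" and pos: "\<And>i. i < n \<Longrightarrow> M i (p i) > 0"
    by auto
  define P :: "nat \<Rightarrow> nat \<Rightarrow> nat" where "P i j = of_bool (j = p i)" for i j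
  define M' where "M' i j = M i j - P i j" for i j
  have M: "M i j = P i j + M' i j" if "i < n" for i j
    using pos[OF that] by (auto simp: M'_def P_def)
  have pin: "p i < n \<longleftrightarrow> i < n" for i
    using permutes_in_image[OF p, of i] by simp
  have rowP: "(\<Sum>j = 0..<n. P i j) = 1" if "i < n" for i
    using that pin by (simp add: P_def of_bool_def)
  have colP: "(\<Sum>i = 0..<n. P i j) = 1" if "j < n" for j
  proof -
    have "(\<Sum>i = 0..<n. P i j) = (\<Sum>i = 0..<n. if i = Hilbert_Choice.inv p j then 1 else 0)"
      by (intro sum.cong) (auto simp: P_def permutes_inverses[OF p])
    also have "\<dots> = 1"
      using that permutes_in_image[OF permutes_inv[OF p], of j] by simp
    finally show ?thesis .
  qed
  have "(\<Prod>i = 0..<n. \<Prod>j = 0..<n. A $$ (i, j) ^ M' i j) \<preceq> per A ^ d"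
  proof (rule Suc.IH)
    show "(\<Sum>j = 0..<n. M' i j) = d" if "i < n" for i
      using Suc.prems(1)[OF that] rowP[OF that] by (simp add: M that sum.distrib)
    show "(\<Sum>i = 0..<n. M' i j) = d" if "j < n" for j
      using Suc.prems(2)[OF that] colP[OF that] by (simp add: M sum.distrib)
  qed
  moreover have "(\<Prod>i = 0..<n. A $$ (i, p i)) \<preceq> per A"
    using summand_below_sum[OF idem, of "{p. p permutes {0..<n}}" p] p
    by (simp add: per_carrier[OF A] finite_permutations)
  moreover have "(\<Prod>i = 0..<n. \<Prod>j = 0..<n. A $$ (i, j) ^ M i j) =
      (\<Prod>i = 0..<n. A $$ (i, p i)) * (\<Prod>i = 0..<n. \<Prod>j = 0..<n. A $$ (i, j) ^ M' i j)"
  proof -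
    have "(\<Prod>j = 0..<n. A $$ (i, j) ^ P i j) = A $$ (i, p i)" if "i < n" for i
    proof -
      have "(\<Prod>j = 0..<n. A $$ (i, j) ^ P i j) = (\<Prod>j = 0..<n. if j = p i then A $$ (i, j) else 1)"
        by (intro prod.cong) (auto simp: P_def)
      also have "\<dots> = A $$ (i, p i)" using that pin by simp
      finally show ?thesis .
    qed
    then show ?thesis
      by (simp add: M power_add prod.distrib)
  qed
  ultimately show ?case
    by (simp add: below_mult_mono)
qed

text \<open>
  The products on the left are the monomials that arise when \<open>per (A * per_adj A)\<close> is multiplied
  out. Replacing row \<open>\<sigma> i\<close> by row \<open>i\<close> in the \<open>i\<close>-th factor unbalances the rows of that factor
  alone; over all factors the rows are balanced again because \<open>\<sigma>\<close> is a permutation.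
\<close>

lemma expanded_term_below_per_power:
  fixes A :: "'a :: comm_semiring_1 mat" and \<tau> :: "nat \<Rightarrow> nat \<Rightarrow> nat"
  assumes idem: "\<And>a :: 'a. a + a = a"
    and A: "A \<in> carrier_mat n n"
    and \<sigma>: "\<sigma> permutes {0..<n}"
    and \<tau>: "\<And>i. i < n \<Longrightarrow> \<tau> i permutes {0..<n}"
  shows "(\<Prod>i = 0..<n. A $$ (i, \<tau> i (\<sigma> i)) * (\<Prod>k\<in>{0..<n} - {\<sigma> i}. A $$ (k, \<tau> i k)))
    \<preceq> per A ^ n"
proof -
  \<comment> \<open>\<open>E i\<close> holds the exponents of the \<open>i\<close>-th factor: first the replacing entry in row \<open>i\<close>, then
    the entries in the rows other than \<open>\<sigma> i\<close>. If \<open>\<sigma> i \<noteq> i\<close>, both occur in row \<open>i\<close>.\<close>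
  define E where "E i r c = (of_bool (r = i \<and> c = \<tau> i (\<sigma> i)) + of_bool (r \<noteq> \<sigma> i \<and> c = \<tau> i r) :: nat)"
    for i r c
  define M where "M r c = (\<Sum>i = 0..<n. E i r c)" for r c
  have \<sigma>n: "\<sigma> i < n \<longleftrightarrow> i < n" for i
    using permutes_in_image[OF \<sigma>, of i] by simp
  have \<tau>n: "\<tau> i k < n \<longleftrightarrow> k < n" if "i < n" for i k
    using permutes_in_image[OF \<tau>[OF that], of k] by simp
  have row: "(\<Sum>c = 0..<n. M r c) = n" if r: "r < n" for r
  proof -
    have E: "(\<Sum>c = 0..<n. E i r c) = of_bool (r = i) + of_bool (r \<noteq> \<sigma> i)" if i: "i < n" for i
    proof -
      have "(\<Sum>c = 0..<n. E i r c) =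
          (\<Sum>c = 0..<n. if c = \<tau> i (\<sigma> i) then of_bool (r = i) else 0) +
          (\<Sum>c = 0..<n. if c = \<tau> i r then of_bool (r \<noteq> \<sigma> i) else 0)"
        unfolding sum.distrib[symmetric] by (intro sum.cong) (auto simp: E_def)
      then show ?thesis using i r by (simp add: \<sigma>n \<tau>n)
    qed
    have "(\<Sum>c = 0..<n. M r c) = (\<Sum>i = 0..<n. \<Sum>c = 0..<n. E i r c)"
      unfolding M_def by (rule sum.swap)
    also have "\<dots> = (\<Sum>i = 0..<n. of_bool (r = i)) + (\<Sum>i = 0..<n. of_bool (r \<noteq> \<sigma> i))"
      by (simp add: E sum.distrib)
    also have "(\<Sum>i = 0..<n. of_bool (r \<noteq> \<sigma> i)) = (\<Sum>i = 0..<n. of_bool (r \<noteq> i) :: nat)"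
      using sum.permute[OF \<sigma>, of "\<lambda>i. of_bool (r \<noteq> i) :: nat"] by (simp add: o_def)
    also have "(\<Sum>i = 0..<n. of_bool (r = i)) + \<dots> = (\<Sum>i = 0..<n. 1)"
      unfolding sum.distrib[symmetric] by (intro sum.cong) auto
    finally show ?thesis by simp
  qed
  have col: "(\<Sum>r = 0..<n. M r c) = n" if c: "c < n" for c
  proof -
    have E: "(\<Sum>r = 0..<n. E i r c) = 1" if i: "i < n" for i
    proof -
      have "(\<Sum>r = 0..<n. E i r c) =
          (\<Sum>r = 0..<n. if r = i then of_bool (c = \<tau> i (\<sigma> i)) else 0) +
          (\<Sum>r = 0..<n. of_bool (r \<noteq> \<sigma> i \<and> c = \<tau> i r))"
        unfolding sum.distrib[symmetric] by (intro sum.cong) (auto simp: E_def)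
      \<comment> \<open>For column sums it does not matter in which row the replacing entry stands; moved to row
        \<open>\<sigma> i\<close>, it completes the permutation \<open>\<tau> i\<close>.\<close>
      also have "(\<Sum>r = 0..<n. if r = i then of_bool (c = \<tau> i (\<sigma> i)) else 0) =
          (\<Sum>r = 0..<n. if r = \<sigma> i then of_bool (c = \<tau> i (\<sigma> i)) else (0 :: nat))"
        using i by (simp add: \<sigma>n)
      also have "\<dots> + (\<Sum>r = 0..<n. of_bool (r \<noteq> \<sigma> i \<and> c = \<tau> i r)) =
          (\<Sum>r = 0..<n. of_bool (c = \<tau> i r))"
        unfolding sum.distrib[symmetric] by (intro sum.cong) auto
      also have "\<dots> = (\<Sum>r = 0..<n. of_bool (c = r))"
        using sum.permute[OF \<tau>[OF i], of "\<lambda>r. of_bool (c = r) :: nat"] by (simp add: o_def)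
      also have "\<dots> = 1"
        using c by (simp add: of_bool_def)
      finally show ?thesis .
    qed
    have "(\<Sum>r = 0..<n. M r c) = (\<Sum>i = 0..<n. \<Sum>r = 0..<n. E i r c)"
      unfolding M_def by (rule sum.swap)
    then show ?thesis by (simp add: E)
  qed
  have factor: "(\<Prod>r = 0..<n. \<Prod>c = 0..<n. A $$ (r, c) ^ E i r c) =
      A $$ (i, \<tau> i (\<sigma> i)) * (\<Prod>k\<in>{0..<n} - {\<sigma> i}. A $$ (k, \<tau> i k))" if i: "i < n" for i
  proof -
    have "(\<Prod>c = 0..<n. A $$ (r, c) ^ E i r c) =
        (if r = i then A $$ (i, \<tau> i (\<sigma> i)) else 1) * (if r \<noteq> \<sigma> i then A $$ (r, \<tau> i r) else 1)"
      if r: "r < n" for r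
    proof -
      have "(\<Prod>c = 0..<n. A $$ (r, c) ^ E i r c) =
          (\<Prod>c = 0..<n. if c = \<tau> i (\<sigma> i) then if r = i then A $$ (r, c) else 1 else 1) *
          (\<Prod>c = 0..<n. if c = \<tau> i r then if r \<noteq> \<sigma> i then A $$ (r, c) else 1 else 1)"
        unfolding prod.distrib[symmetric] by (intro prod.cong) (auto simp: E_def)
      then show ?thesis using i r by (simp add: \<sigma>n \<tau>n)
    qed
    then have "(\<Prod>r = 0..<n. \<Prod>c = 0..<n. A $$ (r, c) ^ E i r c) =
        A $$ (i, \<tau> i (\<sigma> i)) * (\<Prod>r = 0..<n. if r \<noteq> \<sigma> i then A $$ (r, \<tau> i r) else 1)"
      using i by (simp add: prod.distrib)
    also have "(\<Prod>r = 0..<n. if r \<noteq> \<sigma> i then A $$ (r, \<tau> i r) else 1) =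
        (\<Prod>k\<in>{0..<n} - {\<sigma> i}. A $$ (k, \<tau> i k))"
      by (intro prod.mono_neutral_cong_right) auto
    finally show ?thesis .
  qed
  have "(\<Prod>r = 0..<n. \<Prod>c = 0..<n. A $$ (r, c) ^ M r c) =
      (\<Prod>r = 0..<n. \<Prod>i = 0..<n. \<Prod>c = 0..<n. A $$ (r, c) ^ E i r c)"
    unfolding M_def power_sum by (intro prod.cong refl prod.swap)
  also have "\<dots> = (\<Prod>i = 0..<n. \<Prod>r = 0..<n. \<Prod>c = 0..<n. A $$ (r, c) ^ E i r c)"
    by (rule prod.swap)
  also have "\<dots> = (\<Prod>i = 0..<n. A $$ (i, \<tau> i (\<sigma> i)) * (\<Prod>k\<in>{0..<n} - {\<sigma> i}. A $$ (k, \<tau> i k)))"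
    by (simp add: factor)
  finally show ?thesis
    using regular_monomial_below_per_power[OF idem A row col] by simp
qed

section \<open>The permanent of a matrix times its adjoint\<close>

lemma per_mult_per_adj:
  fixes A :: "'a :: comm_semiring_1 mat"
  assumes idem: "\<And>a :: 'a. a + a = a"
    and A: "A \<in> carrier_mat n n"
  shows "per (A * per_adj A) = per A ^ n"
proof (rule below_antisym)
  let ?P = "{p. p permutes {0..<n}}"
  let ?f = "\<lambda>i j p. A $$ (i, p j) * (\<Prod>k\<in>{0..<n} - {j}. A $$ (k, p k))"
  have B: "A * per_adj A \<in> carrier_mat n n"
    using A by (auto simp: per_adj_def)
  note per_B = per_carrier[OF B]
  have "(\<Prod>i = 0..<n. (A * per_adj A) $$ (i, \<sigma> i)) \<preceq> per A ^ n" if \<sigma>: "\<sigma> permutes {0..<n}" for \<sigma>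
  proof -
    have "(\<Prod>i = 0..<n. (A * per_adj A) $$ (i, \<sigma> i)) = (\<Prod>i = 0..<n. \<Sum>p\<in>?P. ?f i (\<sigma> i) p)"
      using permutes_in_image[OF \<sigma>] by (intro prod.cong mult_per_adj_entry[OF A]) auto
    also have "\<dots> = (\<Sum>\<tau>\<in>{0..<n} \<rightarrow>\<^sub>E ?P. \<Prod>i = 0..<n. ?f i (\<sigma> i) (\<tau> i))"
      by (rule prod_sum_PiE) (auto simp: finite_permutations)
    also have "\<dots> \<preceq> per A ^ n"
      by (intro sum_below expanded_term_below_per_power[OF idem A \<sigma>]) auto
    finally show ?thesis .
  qed
  then show "per (A * per_adj A) \<preceq> per A ^ n"
    unfolding per_B by (intro sum_below) simp
  have "(A * per_adj A) $$ (i, i) = per A" if i: "i < n" for i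
    unfolding mult_per_adj_entry[OF A i i] per_carrier[OF A]
    using i by (intro sum.cong refl prod.remove[symmetric]) auto
  then have "per A ^ n = (\<Prod>i = 0..<n. (A * per_adj A) $$ (i, id i))"
    by simp
  also have "\<dots> \<preceq> per (A * per_adj A)"
    unfolding per_B
    by (rule summand_below_sum[OF idem, where x = id]) (simp_all add: finite_permutations permutes_id)
  finally show "per A ^ n \<preceq> per (A * per_adj A)" .
qed

lemma per_adj_transpose:
  assumes A: "A \<in> carrier_mat n n"
  shows "per_adj A\<^sup>T = (per_adj A)\<^sup>T"
proof (rule eq_matI)
  fix i j assume "i < dim_row (per_adj A)\<^sup>T" "j < dim_col (per_adj A)\<^sup>T"
  then have ij: "i < n" "j < n" using A by (auto simp: per_adj_def)
  have "mat_delete A\<^sup>T j i = (mat_delete A i j)\<^sup>T"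
    using A ij by (auto simp: mat_delete_def)
  then show "per_adj A\<^sup>T $$ (i, j) = (per_adj A)\<^sup>T $$ (i, j)"
    using A ij per_transpose[OF mat_delete_carrier[OF A]] by (simp add: per_adj_def)
qed (use A in \<open>auto simp: per_adj_def\<close>)

theorem theorem3p5:
  fixes A :: "'a :: comm_semiring_1 mat" and n :: nat
  assumes add_idem: "\<And>a :: 'a. a + a = a"
    and n: "n \<ge> 2"
    and A: "A \<in> carrier_mat n n"
  shows "per (A * per_adj A) = per A ^ n \<and> per (per_adj A * A) = per A ^ n"
proof
  show "per (A * per_adj A) = per A ^ n"
    using add_idem A by (rule per_mult_per_adj)
  have adj: "per_adj A \<in> carrier_mat n n"
    using A by (simp add: per_adj_def)
  have "(per_adj A * A)\<^sup>T = A\<^sup>T * per_adj A\<^sup>T"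
    using transpose_mult[OF adj A] by (simp add: per_adj_transpose[OF A])
  then have "per (per_adj A * A) = per (A\<^sup>T * per_adj A\<^sup>T)"
    using per_transpose[OF mult_carrier_mat[OF adj A]] by simp
  also have "\<dots> = per A\<^sup>T ^ n"
    using A by (intro per_mult_per_adj add_idem) simp
  finally show "per (per_adj A * A) = per A ^ n"
    by (simp add: per_transpose[OF A])
qed

end
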